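(* Let $\mathbb{K}$ be a field and let $m_1,m_2$ be non-negative integers. The number of dominant monomial ideals in $\mathbb{K}[x,y]$ whose lcm is $x^{m_1}y^{m_2}$ is $1+m_1m_2$.
   Context: Let $S$ be a polynomial ring over a field in finitely many variables. For a monomial $u$ and a variable $x_i$, $\deg_{x_i}u$ denotes the exponent of $x_i$ in $u$. For a monomial ideal $I$, $G(I)$ denotes its unique minimal set of monomial generators. A monomial $v$ in a finite set $L$ of monomials is dominant in $L$ if there is a variable $x_i$ with $\deg_{x_i}v>\deg_{x_i}w$ for all $w\in L\setminus\{v\}$. The set $L$ is a dominant set if every element of $L$ is dominant in $L$ (in particular, a one-element set is dominant), and $I$ is a dominant ideal if $G(I)$ is a dominant set. The lcm of a nonzero monomial ideal $I$ is the least common multiple of the elements of $G(I)$; the zero ideal is not assigned an lcm and is not counted. *)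

theory Defs
  imports Complex_Main "HOL-Library.Poly_Mapping"
begin

text \<open>
  The polynomial ring over \<open>'k\<close> in the finitely many variables \<open>'v\<close>: a polynomial is a finitely
  supported map from exponent vectors \<open>'v \<Rightarrow>\<^sub>0 nat\<close> to coefficients, multiplied by convolution.
\<close>

type_synonym ('v, 'k) mpoly = "('v \<Rightarrow>\<^sub>0 nat) \<Rightarrow>\<^sub>0 'k"

definition Var :: "'v \<Rightarrow> ('v::finite, 'k::field) mpoly" where
  "Var i = Poly_Mapping.single (Poly_Mapping.single i 1) 1"

text \<open>Monomials have coefficient 1.\<close>

definition is_monomial :: "('v::finite, 'k::field) mpoly \<Rightarrow> bool" where
  "is_monomial u \<longleftrightarrow> (\<exists>t. u = Poly_Mapping.single t 1)"

text \<open>Only used for nonzero polynomials (\<open>Max {}\<close> is unspecified).\<close>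

definition deg :: "'v \<Rightarrow> ('v::finite, 'k::field) mpoly \<Rightarrow> nat" where
  "deg i p = Max ((\<lambda>t. Poly_Mapping.lookup t i) ` Poly_Mapping.keys p)"

lemma deg_monomial:
  "deg i (Poly_Mapping.single t 1 :: ('v::finite, 'k::field) mpoly) = Poly_Mapping.lookup t i"
  by (simp add: deg_def)

text \<open>
  A commutative ring is a module over itself, and its ideals are the submodules; so \<open>module.span\<close>
  over ring multiplication is the ideal generated by a set.
\<close>

lemma module_ring: "module ((*) :: 'a::comm_ring_1 \<Rightarrow> 'a \<Rightarrow> 'a)"
  by unfold_locales (simp_all add: algebra_simps)

definition ideal_generated :: "'a::comm_ring_1 set \<Rightarrow> 'a set" where
  "ideal_generated A = module.span (*) A"

definition monomial_ideal :: "('v::finite, 'k::field) mpoly set \<Rightarrow> bool" where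
  "monomial_ideal I \<longleftrightarrow> (\<exists>A. (\<forall>u\<in>A. is_monomial u) \<and> I = ideal_generated A)"

definition min_gens :: "('v::finite, 'k::field) mpoly set \<Rightarrow> ('v, 'k) mpoly set" where
  "min_gens I = (THE G. (\<forall>u\<in>G. is_monomial u) \<and> ideal_generated G = I \<and>
                        (\<forall>H. H \<subset> G \<longrightarrow> ideal_generated H \<noteq> I))"

definition dominant_in :: "('v::finite, 'k::field) mpoly set \<Rightarrow> ('v, 'k) mpoly \<Rightarrow> bool" where
  "dominant_in L v \<longleftrightarrow> (\<exists>i. \<forall>w\<in>L - {v}. deg i v > deg i w)"

definition dominant_set :: "('v::finite, 'k::field) mpoly set \<Rightarrow> bool" where
  "dominant_set L \<longleftrightarrow> finite L \<and> (\<forall>v\<in>L. dominant_in L v)"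

definition dominant_ideal :: "('v::finite, 'k::field) mpoly set \<Rightarrow> bool" where
  "dominant_ideal I \<longleftrightarrow> monomial_ideal I \<and> dominant_set (min_gens I)"

definition is_lcm :: "'a::comm_semiring_1 \<Rightarrow> 'a set \<Rightarrow> bool" where
  "is_lcm m L \<longleftrightarrow> (\<forall>u\<in>L. u dvd m) \<and> (\<forall>w. (\<forall>u\<in>L. u dvd w) \<longrightarrow> m dvd w)"

text \<open>
  The lcm is normalised to be a monomial, which makes it unique. The zero ideal has none; it must
  be excluded explicitly, as 1 is an lcm of its empty set of generators.
\<close>

definition has_lcm :: "('v::finite, 'k::field) mpoly set \<Rightarrow> ('v, 'k) mpoly \<Rightarrow> bool" where
  "has_lcm I m \<longleftrightarrow> I \<noteq> {0} \<and> is_monomial m \<and> is_lcm m (min_gens I)"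

datatype xy = X | Y

instance xy :: finite
proof
  have "(UNIV :: xy set) = {X, Y}"
    using xy.exhaust by blast
  then show "finite (UNIV :: xy set)"
    by (metis finite.emptyI finite_insert)
qed

end

theory Submission
  imports Defs
begin

text \<open>
  A monomial ideal is determined by the antichain of its minimal exponent vectors, so everything can
  be counted on exponents. In a dominant set distinct elements are dominant in distinct variables;
  in two variables such a set therefore is either a single monomial, necessarily the lcm, or
  consists of \<open>x\<^bsup>m\<^sub>1\<^esup> y\<^bsup>b\<^esup>\<close> and \<open>x\<^bsup>a\<^esup> y\<^bsup>m\<^sub>2\<^esup>\<close> with \<open>a < m\<^sub>1\<close> and \<open>b < m\<^sub>2\<close>.
\<close>

section \<open>Monomials and their exponent vectors\<close>

definition mon :: "('v::finite \<Rightarrow>\<^sub>0 nat) \<Rightarrow> ('v, 'k::field) mpoly" where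
  "mon t = Poly_Mapping.single t 1"

text \<open>This is divisibility of monomials read on exponents; \<open>mon_dvd_iff\<close> makes
  the link.\<close>

definition exp_le :: "('v \<Rightarrow>\<^sub>0 nat) \<Rightarrow> ('v \<Rightarrow>\<^sub>0 nat) \<Rightarrow> bool" (infix "\<preceq>" 50) where
  "s \<preceq> t \<longleftrightarrow> (\<forall>i. Poly_Mapping.lookup s i \<le> Poly_Mapping.lookup t i)"

lemma exp_le_refl [simp]: "t \<preceq> t"
  by (simp add: exp_le_def)

lemma exp_le_trans: "s \<preceq> t \<Longrightarrow> t \<preceq> u \<Longrightarrow> s \<preceq> u"
  unfolding exp_le_def using le_trans by blast

lemma exp_le_antisym: "s \<preceq> t \<Longrightarrow> t \<preceq> s \<Longrightarrow> s = t"
  by (auto simp: exp_le_def intro!: poly_mapping_eqI le_antisym)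

lemma exp_le_add: "s \<preceq> k + s"
  by (simp add: exp_le_def lookup_add)

text \<open>Subtraction of exponents is truncated at 0 in each variable, so it gives the exponent of
  a true quotient only under divisibility.\<close>

lemma exp_le_minus_add: "s \<preceq> t \<Longrightarrow> (t - s) + s = t"
  by (auto simp: exp_le_def lookup_add lookup_minus intro!: poly_mapping_eqI)

lemma keys_mon [simp]: "Poly_Mapping.keys (mon t :: ('v::finite, 'k::field) mpoly) = {t}"
  by (simp add: mon_def)

lemma mon_eq_iff [simp]: "(mon s :: ('v::finite, 'k::field) mpoly) = mon t \<longleftrightarrow> s = t"
  by (metis keys_mon singleton_inject)

lemma inj_mon: "inj (mon :: _ \<Rightarrow> ('v::finite, 'k::field) mpoly)"
  by (simp add: inj_def)

lemma mon_image_eq_iff [simp]: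
  "(mon ` S :: ('v::finite, 'k::field) mpoly set) = mon ` T \<longleftrightarrow> S = T"
  by (simp add: inj_image_eq_iff inj_mon)

lemma deg_mon [simp]: "deg i (mon t :: ('v::finite, 'k::field) mpoly) = Poly_Mapping.lookup t i"
  by (simp add: mon_def deg_monomial)

lemma is_monomial_mon [simp]: "is_monomial (mon t)"
  by (auto simp: is_monomial_def mon_def)

lemma monomial_set_conv:
  "(\<forall>u\<in>A. is_monomial u) \<longleftrightarrow> (\<exists>T. A = (mon ` T :: ('v::finite, 'k::field) mpoly set))"
proof
  assume "\<forall>u\<in>A. is_monomial u"
  then have "A = mon ` {t. mon t \<in> A}"
    by (auto simp: is_monomial_def mon_def image_iff)
  then show "\<exists>T. A = mon ` T" by blast
qed auto

section \<open>Membership and inclusion for monomial ideals\<close>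

definition mon_ideal :: "('v::finite \<Rightarrow>\<^sub>0 nat) set \<Rightarrow> ('v, 'k::field) mpoly set" where
  "mon_ideal T = ideal_generated (mon ` T)"

text \<open>The condition on keys survives adding a multiple of a generator, since each key of the
  product is the generator's exponent plus something. Conversely, \<open>p\<close> is the sum of its
  terms, and each term is a multiple of a generator.\<close>

lemma mem_mon_ideal:
  fixes p :: "('v::finite, 'k::field) mpoly"
  shows "p \<in> mon_ideal T \<longleftrightarrow> (\<forall>t\<in>Poly_Mapping.keys p. \<exists>s\<in>T. s \<preceq> t)"
proof
  interpret R: module "(*) :: ('v, 'k) mpoly \<Rightarrow> _" by (rule module_ring)
  assume "p \<in> mon_ideal T"
  then have "p \<in> R.span (mon ` T)"
    by (simp add: mon_ideal_def ideal_generated_def)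
  then show "\<forall>t\<in>Poly_Mapping.keys p. \<exists>s\<in>T. s \<preceq> t"
  proof (induction rule: R.span_induct_alt)
    case base
    show ?case by simp
  next
    case (step c x y)
    then obtain s where s: "s \<in> T" "x = mon s" by blast
    show ?case
    proof
      fix t assume "t \<in> Poly_Mapping.keys (c * x + y)"
      then consider "t \<in> Poly_Mapping.keys (c * x)" | "t \<in> Poly_Mapping.keys y"
        using Poly_Mapping.keys_add[of "c * x" y] by blast
      then show "\<exists>s\<in>T. s \<preceq> t"
      proof cases
        case 1
        then obtain k where "t = k + s"
          using keys_mult[of c x] s(2) by auto
        then show ?thesis using s(1) exp_le_add by blast
      next
        case 2
        then show ?thesis using step by blast
      qed
    qed
  qed
next
  interpret R: module "(*) :: ('v, 'k) mpoly \<Rightarrow> _" by (rule module_ring)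
  assume *: "\<forall>t\<in>Poly_Mapping.keys p. \<exists>s\<in>T. s \<preceq> t"
  have "Poly_Mapping.single t (Poly_Mapping.lookup p t) \<in> R.span (mon ` T)"
    if t: "t \<in> Poly_Mapping.keys p" for t
  proof -
    obtain s where s: "s \<in> T" "s \<preceq> t" using * t by blast
    \<comment> \<open>The cofactor carries the coefficient of the term and the quotient exponent, so
      that the product is the term itself.\<close>
    have "Poly_Mapping.single (t - s) (Poly_Mapping.lookup p t) * mon s \<in> R.span (mon ` T)"
      by (intro R.span_scale R.span_base imageI s)
    then show ?thesis
      by (simp add: mon_def mult_single exp_le_minus_add s)
  qed
  moreover have "p = (\<Sum>t\<in>Poly_Mapping.keys p. Poly_Mapping.single t (Poly_Mapping.lookup p t))"
    by (rule poly_mapping_eqI) (simp add: lookup_sum lookup_single when_def in_keys_iff)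
  ultimately have "p \<in> R.span (mon ` T)"
    by (metis (no_types, lifting) R.span_sum)
  then show "p \<in> mon_ideal T"
    by (simp add: mon_ideal_def ideal_generated_def)
qed

text \<open>The multiples of a monomial form the ideal that it generates, so this is the membership
  criterion for one generator.\<close>

lemma mon_dvd_iff:
  fixes p :: "('v::finite, 'k::field) mpoly"
  shows "mon s dvd p \<longleftrightarrow> (\<forall>t\<in>Poly_Mapping.keys p. s \<preceq> t)"
proof -
  interpret R: module "(*) :: ('v, 'k) mpoly \<Rightarrow> _" by (rule module_ring)
  have "mon s dvd p \<longleftrightarrow> p \<in> mon_ideal {s}"
    by (auto simp: mon_ideal_def ideal_generated_def R.span_singleton dvd_def mult.commute)
  then show ?thesis by (simp add: mem_mon_ideal)
qed

lemma mon_ideal_subset_iff: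
  "(mon_ideal S :: ('v::finite, 'k::field) mpoly set) \<subseteq> mon_ideal T \<longleftrightarrow> (\<forall>s\<in>S. \<exists>t\<in>T. t \<preceq> s)"
proof
  assume *: "(mon_ideal S :: ('v, 'k) mpoly set) \<subseteq> mon_ideal T"
  show "\<forall>s\<in>S. \<exists>t\<in>T. t \<preceq> s"
  proof
    fix s assume "s \<in> S"
    then have "(mon s :: ('v, 'k) mpoly) \<in> mon_ideal S"
      by (auto simp: mem_mon_ideal intro: exp_le_refl)
    then have "(mon s :: ('v, 'k) mpoly) \<in> mon_ideal T" using * by blast
    then show "\<exists>t\<in>T. t \<preceq> s" by (simp add: mem_mon_ideal)
  qed
qed (meson exp_le_trans mem_mon_ideal subsetI)

section \<open>Antichains and minimal generators\<close>

definition antichain :: "('v \<Rightarrow>\<^sub>0 nat) set \<Rightarrow> bool" where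
  "antichain T \<longleftrightarrow> (\<forall>s\<in>T. \<forall>t\<in>T. s \<preceq> t \<longrightarrow> s = t)"

text \<open>Below \<open>t\<close> lies some \<open>u\<close> in \<open>U\<close>, and below
  \<open>u\<close> some \<open>t'\<close> in \<open>T\<close>. The antichain property forces
  \<open>t' = t\<close>, so \<open>u\<close> is squeezed to \<open>t\<close>.\<close>

lemma antichain_subset_generators:
  assumes "antichain T" "(mon_ideal U :: ('v::finite, 'k::field) mpoly set) = mon_ideal T"
  shows "T \<subseteq> U"
proof
  fix t assume t: "t \<in> T"
  have UT: "\<forall>u\<in>U. \<exists>t\<in>T. t \<preceq> u" and TU: "\<forall>t\<in>T. \<exists>u\<in>U. u \<preceq> t"
    using assms(2) by (simp_all flip: mon_ideal_subset_iff[where ?'k = 'k])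
  obtain u where u: "u \<in> U" "u \<preceq> t" using TU t by blast
  then obtain t' where t': "t' \<in> T" "t' \<preceq> u" using UT by blast
  then have "t' = t" using assms(1) t u exp_le_trans unfolding antichain_def by blast
  then show "t \<in> U" using t' u exp_le_antisym by blast
qed

text \<open>Every monomial generating set contains \<open>mon\<close>
  T\<open>. This yields both the minimality of\<close>mon \<open>T\<close> and its uniqueness, as
  the definite description in \<open>min_gens\<close> requires.\<close>

lemma min_gens_antichain:
  assumes T: "antichain T"
  shows "min_gens (mon_ideal T :: ('v::finite, 'k::field) mpoly set) = mon ` T"
  unfolding min_gens_def
proof (rule the_equality, intro conjI allI impI)
  fix H :: "('v, 'k) mpoly set" assume H: "H \<subset> mon ` T"
  then obtain U where U: "H = mon ` U" "U \<subseteq> T" by (meson psubsetE subset_imageE)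
  show "ideal_generated H \<noteq> mon_ideal T"
    using antichain_subset_generators[OF T, of U] U H by (auto simp: mon_ideal_def)
next
  fix G :: "('v, 'k) mpoly set"
  assume G: "(\<forall>u\<in>G. is_monomial u) \<and> ideal_generated G = mon_ideal T \<and>
     (\<forall>H. H \<subset> G \<longrightarrow> ideal_generated H \<noteq> mon_ideal T)"
  then obtain U where U: "G = mon ` U" by (auto simp: monomial_set_conv)
  then have "(mon_ideal U :: ('v, 'k) mpoly set) = mon_ideal T"
    using G by (simp add: mon_ideal_def)
  then have "T \<subseteq> U" by (rule antichain_subset_generators[OF T])
  then have "mon ` T \<subseteq> G" using U by blast
  moreover have "\<not> mon ` T \<subset> G" using G unfolding mon_ideal_def by blast
  ultimately show "G = mon ` T" by blast
qed (auto simp: mon_ideal_def)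

text \<open>The antichain is recovered from its ideal through \<open>min_gens\<close>.\<close>

lemma inj_on_mon_ideal: "inj_on (mon_ideal :: _ \<Rightarrow> ('v::finite, 'k::field) mpoly set) {T. antichain T}"
  by (metis (mono_tags) inj_onI mem_Collect_eq min_gens_antichain mon_image_eq_iff)

text \<open>Passing to a proper divisor lowers the total degree, so the descent stops, even when
  \<open>T\<close> is infinite.\<close>

lemma minimal_exponent_below:
  fixes t :: "'v::finite \<Rightarrow>\<^sub>0 nat"
  assumes "t \<in> T"
  shows "\<exists>s\<in>T. s \<preceq> t \<and> (\<forall>r\<in>T. r \<preceq> s \<longrightarrow> r = s)"
  using assms
proof (induction "\<Sum>i\<in>UNIV. Poly_Mapping.lookup t i" arbitrary: t rule: less_induct)
  case less
  show ?case
  proof (cases "\<forall>r\<in>T. r \<preceq> t \<longrightarrow> r = t")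
    case True
    then show ?thesis using less.prems by (auto intro: exp_le_refl)
  next
    case False
    then obtain r where r: "r \<in> T" "r \<preceq> t" "r \<noteq> t" by blast
    then obtain i where "Poly_Mapping.lookup r i < Poly_Mapping.lookup t i"
      by (metis exp_le_antisym exp_le_def not_le)
    then have "(\<Sum>i\<in>UNIV. Poly_Mapping.lookup r i) < (\<Sum>i\<in>UNIV. Poly_Mapping.lookup t i)"
      using r(2) by (intro sum_strict_mono_ex1) (auto simp: exp_le_def)
    then show ?thesis using less.hyps r exp_le_trans by blast
  qed
qed

text \<open>The minimal elements of any generating set of exponents form an antichain, and they
  generate the same ideal because each exponent lies above a minimal one.\<close>

lemma monomial_ideal_conv:
  "monomial_ideal (I :: ('v::finite, 'k::field) mpoly set) \<longleftrightarrow> (\<exists>T. antichain T \<and> I = mon_ideal T)"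
proof
  assume "monomial_ideal I"
  then obtain T where I: "I = mon_ideal T"
    by (auto simp: monomial_ideal_def monomial_set_conv mon_ideal_def)
  define M where "M = {s \<in> T. \<forall>r\<in>T. r \<preceq> s \<longrightarrow> r = s}"
  have "antichain M" by (auto simp: antichain_def M_def)
  moreover have "(mon_ideal T :: ('v, 'k) mpoly set) \<subseteq> mon_ideal M"
    unfolding mon_ideal_subset_iff M_def using minimal_exponent_below by blast
  moreover have "(mon_ideal M :: ('v, 'k) mpoly set) \<subseteq> mon_ideal T"
    unfolding mon_ideal_subset_iff M_def using exp_le_refl by blast
  ultimately show "\<exists>T. antichain T \<and> I = mon_ideal T" using I by blast
qed (auto simp: monomial_ideal_def monomial_set_conv mon_ideal_def)

section \<open>Dominance and lcm on exponents\<close>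

definition dominant_exps :: "('v \<Rightarrow>\<^sub>0 nat) set \<Rightarrow> bool" where
  "dominant_exps T \<longleftrightarrow> finite T \<and>
     (\<forall>t\<in>T. \<exists>i. \<forall>s\<in>T - {t}. Poly_Mapping.lookup s i < Poly_Mapping.lookup t i)"

lemma dominant_set_mon_image:
  "dominant_set (mon ` T :: ('v::finite, 'k::field) mpoly set) \<longleftrightarrow> dominant_exps T"
proof -
  have "mon ` T - {mon t} = (mon ` (T - {t}) :: ('v, 'k) mpoly set)" for t by auto
  then show ?thesis
    by (simp add: dominant_set_def dominant_in_def dominant_exps_def finite_image_iff
        inj_on_subset[OF inj_mon])
qed

lemma dominant_exps_antichain: "dominant_exps T \<Longrightarrow> antichain T"
  unfolding dominant_exps_def antichain_def exp_le_def
  by (metis Diff_iff leD singletonD)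

definition is_lub :: "('v \<Rightarrow>\<^sub>0 nat) \<Rightarrow> ('v \<Rightarrow>\<^sub>0 nat) set \<Rightarrow> bool" where
  "is_lub l T \<longleftrightarrow> (\<forall>t\<in>T. t \<preceq> l) \<and> (\<forall>k. (\<forall>t\<in>T. t \<preceq> k) \<longrightarrow> l \<preceq> k)"

text \<open>The lcm is tested against all polynomials, the least upper bound only against exponents.
  The two tests agree because a monomial divides a polynomial exactly when it divides each of its
  terms.\<close>

lemma is_lcm_mon_image:
  "is_lcm (mon l :: ('v::finite, 'k::field) mpoly) (mon ` T) \<longleftrightarrow> is_lub l T"
proof
  assume *: "is_lcm (mon l :: ('v, 'k) mpoly) (mon ` T)"
  have "l \<preceq> k" if "\<forall>t\<in>T. t \<preceq> k" for k
  proof -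
    have "\<forall>t\<in>T. (mon t :: ('v, 'k) mpoly) dvd mon k"
      using that by (simp add: mon_dvd_iff)
    then have "(mon l :: ('v, 'k) mpoly) dvd mon k"
      using * unfolding is_lcm_def by blast
    then show ?thesis by (simp add: mon_dvd_iff)
  qed
  then show "is_lub l T" using * by (simp add: is_lcm_def is_lub_def mon_dvd_iff)
next
  assume "is_lub l T"
  then show "is_lcm (mon l :: ('v, 'k) mpoly) (mon ` T)"
    by (simp add: is_lcm_def is_lub_def mon_dvd_iff)
qed

lemma mon_ideal_eq_zero_iff: "(mon_ideal T :: ('v::finite, 'k::field) mpoly set) = {0} \<longleftrightarrow> T = {}"
proof
  assume *: "(mon_ideal T :: ('v, 'k) mpoly set) = {0}"
  have False if "t \<in> T" for t
  proof -
    have "(mon t :: ('v, 'k) mpoly) \<in> mon_ideal T"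
      using that by (auto simp: mem_mon_ideal intro: bexI[of _ t])
    then have "(mon t :: ('v, 'k) mpoly) = 0" using * by blast
    then show False using keys_mon[of t, where ?'k = 'k] by simp
  qed
  then show "T = {}" by blast
qed (auto simp: mem_mon_ideal)

text \<open>This moves the count from ideals to sets of exponents. Excluding the zero ideal becomes
  \<open>T \<noteq> {}\<close>.\<close>

lemma dominant_ideals_with_lcm:
  "{I :: ('v::finite, 'k::field) mpoly set. dominant_ideal I \<and> has_lcm I (mon l)} =
     mon_ideal ` {T. dominant_exps T \<and> T \<noteq> {} \<and> is_lub l T}" (is "?L = ?R")
proof
  show "?L \<subseteq> ?R"
  proof
    fix I :: "('v, 'k) mpoly set" assume I: "I \<in> ?L"
    then obtain T where T: "antichain T" "I = mon_ideal T"
      by (auto simp: dominant_ideal_def monomial_ideal_conv)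
    then show "I \<in> ?R"
      using I by (auto simp: dominant_ideal_def has_lcm_def min_gens_antichain
          dominant_set_mon_image is_lcm_mon_image mon_ideal_eq_zero_iff)
  qed
  show "?R \<subseteq> ?L"
    by (auto simp: dominant_ideal_def has_lcm_def min_gens_antichain dominant_exps_antichain
        dominant_set_mon_image is_lcm_mon_image mon_ideal_eq_zero_iff monomial_ideal_conv
        intro: dominant_exps_antichain)
qed

section \<open>The case of two variables\<close>

definition expo :: "nat \<Rightarrow> nat \<Rightarrow> xy \<Rightarrow>\<^sub>0 nat" where
  "expo a b = Poly_Mapping.single X a + Poly_Mapping.single Y b"

lemma lookup_expo [simp]:
  "Poly_Mapping.lookup (expo a b) X = a" "Poly_Mapping.lookup (expo a b) Y = b"
  by (simp_all add: expo_def lookup_add lookup_single)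

lemma all_xy: "(\<forall>i. P i) \<longleftrightarrow> P X \<and> P Y"
  by (metis xy.exhaust)

lemma ex_xy: "(\<exists>i. P i) \<longleftrightarrow> P X \<or> P Y"
  by (metis xy.exhaust)

lemma exp_le_xy:
  "s \<preceq> t \<longleftrightarrow> Poly_Mapping.lookup s X \<le> Poly_Mapping.lookup t X
            \<and> Poly_Mapping.lookup s Y \<le> Poly_Mapping.lookup t Y"
  by (simp add: exp_le_def all_xy)

lemma exp_xy_eq_iff:
  fixes s t :: "xy \<Rightarrow>\<^sub>0 nat"
  shows "s = t \<longleftrightarrow> Poly_Mapping.lookup s X = Poly_Mapping.lookup t X
            \<and> Poly_Mapping.lookup s Y = Poly_Mapping.lookup t Y"
  using exp_le_antisym[of s t] by (auto simp: exp_le_xy)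

lemma Var_power: "(Var i :: ('v::finite, 'k::field) mpoly) ^ n = mon (Poly_Mapping.single i n)"
  by (induction n) (simp_all add: Var_def mon_def mult_single flip: single_add single_one)

lemma Var_power_mult: "Var X ^ a * Var Y ^ b = (mon (expo a b) :: (xy, 'k::field) mpoly)"
  by (simp add: Var_power) (simp add: mon_def expo_def mult_single)

lemma is_lub_singleton: "is_lub l {t} \<longleftrightarrow> t = l"
  by (auto simp: is_lub_def intro: exp_le_antisym exp_le_trans)

lemma dominant_exps_xy_lub:
  "dominant_exps T \<and> T \<noteq> {} \<and> is_lub (expo m n) T \<longleftrightarrow>
     T = {expo m n} \<or> (\<exists>a<m. \<exists>b<n. T = {expo m b, expo a n})" (is "?L \<longleftrightarrow> ?R")
proof
  assume L: ?L
  show ?R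
  proof (cases "\<exists>t. T = {t}")
    case True
    then show ?thesis using L by (auto simp: is_lub_singleton)
  next
    case False
    have dom: "(\<forall>s\<in>T - {t}. Poly_Mapping.lookup s X < Poly_Mapping.lookup t X) \<or>
               (\<forall>s\<in>T - {t}. Poly_Mapping.lookup s Y < Poly_Mapping.lookup t Y)" if "t \<in> T" for t
      using L that by (simp add: dominant_exps_def ex_xy)
    obtain p q where pq: "p \<in> T" "q \<in> T" "p \<noteq> q" using L False by blast
    \<comment> \<open>Two distinct elements cannot be dominant in the same variable, so
      \<open>p\<close> and \<open>q\<close> use different ones; \<open>t\<close> names the one using
      \<open>X\<close> and \<open>s\<close> the one using \<open>Y\<close>.\<close>
    obtain t s where ts: "t \<in> T" "s \<in> T" "t \<noteq> s"
      and t: "\<forall>r\<in>T - {t}. Poly_Mapping.lookup r X < Poly_Mapping.lookup t X"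
      and s: "\<forall>r\<in>T - {s}. Poly_Mapping.lookup r Y < Poly_Mapping.lookup s Y"
      using dom[OF pq(1)] dom[OF pq(2)] pq by (metis DiffI singletonD less_asym)
    \<comment> \<open>A third element would share its variable with \<open>t\<close> or with
      \<open>s\<close>.\<close>
    have "r = t \<or> r = s" if "r \<in> T" for r
      using dom[OF that] that ts t s by (metis DiffI singletonD less_asym)
    then have T: "T = {t, s}" using ts by blast
    have lt: "Poly_Mapping.lookup s X < Poly_Mapping.lookup t X"
             "Poly_Mapping.lookup t Y < Poly_Mapping.lookup s Y"
      using ts t s by auto
    \<comment> \<open>The candidate is the componentwise maximum of \<open>t\<close> and
      \<open>s\<close>, so it must coincide with the least upper bound
      \<open>expo m n\<close>.\<close>
    have "\<forall>r\<in>T. r \<preceq> expo (Poly_Mapping.lookup t X) (Poly_Mapping.lookup s Y)"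
      using lt by (simp add: T exp_le_xy)
    then have "expo m n \<preceq> expo (Poly_Mapping.lookup t X) (Poly_Mapping.lookup s Y)"
      using L by (simp add: is_lub_def)
    moreover have "t \<preceq> expo m n" "s \<preceq> expo m n" using L by (simp_all add: is_lub_def T)
    ultimately have mn: "m = Poly_Mapping.lookup t X" "n = Poly_Mapping.lookup s Y"
      by (simp_all add: exp_le_xy)
    have "t = expo m (Poly_Mapping.lookup t Y)" "s = expo (Poly_Mapping.lookup s X) n"
      by (simp_all add: exp_xy_eq_iff mn)
    then show ?thesis using T lt mn by metis
  qed
next
  assume ?R
  then show ?L
  proof (elim disjE exE conjE)
    assume "T = {expo m n}"
    then show ?L by (simp add: is_lub_singleton dominant_exps_def)
  next
    fix a b assume "a < m" "b < n" and T: "T = {expo m b, expo a n}"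
    then show ?L
      by (auto simp: dominant_exps_def ex_xy is_lub_def exp_le_xy)
  qed
qed

lemma card_dominant_exps_xy_lub:
  "card {T. dominant_exps T \<and> T \<noteq> {} \<and> is_lub (expo m n) T} = 1 + m * n"
proof -
  let ?f = "\<lambda>(a, b). {expo m b, expo a n}"
  have "{T. dominant_exps T \<and> T \<noteq> {} \<and> is_lub (expo m n) T} =
      insert {expo m n} (?f ` ({..<m} \<times> {..<n}))"
    unfolding dominant_exps_xy_lub by auto
  \<comment> \<open>Matching the pairs crosswise would give an element with \<open>X\<close>
    exponent both equal to \<open>m\<close> and below \<open>m\<close>.\<close>
  moreover have "inj_on ?f ({..<m} \<times> {..<n})"
    by (auto simp: inj_on_def doubleton_eq_iff exp_xy_eq_iff)
  \<comment> \<open>Each set in the image has an element whose \<open>X\<close> exponent is below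
    \<open>m\<close>.\<close>
  moreover have "{expo m n} \<notin> ?f ` ({..<m} \<times> {..<n})"
    by (auto simp: exp_xy_eq_iff set_eq_iff)
  ultimately show ?thesis by (simp add: card_image)
qed

theorem proposition3p4:
  fixes m\<^sub>1 m\<^sub>2 :: nat
  shows "card {I :: (xy, 'k::field) mpoly set.
                 dominant_ideal I \<and> has_lcm I (Var X ^ m\<^sub>1 * Var Y ^ m\<^sub>2)} = 1 + m\<^sub>1 * m\<^sub>2"
  unfolding Var_power_mult dominant_ideals_with_lcm card_dominant_exps_xy_lub[symmetric]
  \<comment> \<open>Dominant sets are antichains, on which \<open>mon_ideal\<close> is injective, so
    ideals and exponent sets are equally many.\<close>
  by (intro card_image inj_on_subset[OF inj_on_mon_ideal]) (auto intro: dominant_exps_antichain)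

end
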